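(* Let $\mathfrak{g}$ be a finite-dimensional perfect complex Lie algebra (i.e. $[\mathfrak{g},\mathfrak{g}]=\mathfrak{g}$). Then every CPA-structure on $\mathfrak{g}$ is trivial, i.e. satisfies $x\cdot y=0$ for all $x,y\in\mathfrak{g}$.
   Context: A commutative post-Lie algebra structure (CPA-structure) on a Lie algebra $\mathfrak{g}$ with bracket $[\,,]$ on the vector space $V$ is a bilinear product $x\cdot y$ on $V$ satisfying, for all $x,y,z$: $x\cdot y=y\cdot x$; $[x,y]\cdot z=x\cdot(y\cdot z)-y\cdot(x\cdot z)$; $x\cdot[y,z]=[x\cdot y,z]+[y,x\cdot z]$. The trivial CPA-structure is $x\cdot y=0$ for all $x,y$. *)

theory Defs
  imports Complex_Main
begin

definition lie_algebra :: "(complex \<Rightarrow> 'a::ab_group_add \<Rightarrow> 'a) \<Rightarrow> ('a \<Rightarrow> 'a \<Rightarrow> 'a) \<Rightarrow> bool" where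
  "lie_algebra sc br \<longleftrightarrow>
     vector_space sc \<and>
     (\<forall>x. Vector_Spaces.linear sc sc (br x)) \<and>
     (\<forall>y. Vector_Spaces.linear sc sc (\<lambda>x. br x y)) \<and>
     (\<forall>x. br x x = 0) \<and>
     (\<forall>x y z. br x (br y z) + br y (br z x) + br z (br x y) = 0)"

definition fin_dim :: "(complex \<Rightarrow> 'a::ab_group_add \<Rightarrow> 'a) \<Rightarrow> bool" where
  "fin_dim sc \<longleftrightarrow> (\<exists>B. finite_dimensional_vector_space sc B)"

definition perfect_lie :: "(complex \<Rightarrow> 'a::ab_group_add \<Rightarrow> 'a) \<Rightarrow> ('a \<Rightarrow> 'a \<Rightarrow> 'a) \<Rightarrow> bool" where
  "perfect_lie sc br \<longleftrightarrow> module.span sc {br x y | x y. True} = UNIV"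

definition CPA_structure :: "(complex \<Rightarrow> 'a::ab_group_add \<Rightarrow> 'a) \<Rightarrow> ('a \<Rightarrow> 'a \<Rightarrow> 'a) \<Rightarrow> ('a \<Rightarrow> 'a \<Rightarrow> 'a) \<Rightarrow> bool" where
  "CPA_structure sc br p \<longleftrightarrow>
     (\<forall>x. Vector_Spaces.linear sc sc (p x)) \<and>
     (\<forall>y. Vector_Spaces.linear sc sc (\<lambda>x. p x y)) \<and>
     (\<forall>x y. p x y = p y x) \<and>
     (\<forall>x y z. p (br x y) z = p x (p y z) - p y (p x z)) \<and>
     (\<forall>x y z. p x (br y z) = br (p x y) z + br y (p x z))"

end

theory Submission
  imports Defs "HOL-Computational_Algebra.Fundamental_Theorem_Algebra"
begin

text \<open>
  The form \<open>killing (x \<cdot> y) z\<close> is symmetric in \<open>x, y\<close> and antisymmetric in \<open>y, z\<close>, hence zero, so all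
  products lie in the radical of the Killing form. That radical is solvable: the derivation acting on
  generalised eigenspaces of \<open>ad x\<close> by the conjugate eigenvalue shows, by a trace computation, that the
  stable term of its derived series consists of ad-nilpotent elements, and Engel's theorem kills a
  perfect ideal of this kind. Finally, for a perfect algebra, products lying in an ideal \<open>I\<close> already
  lie in \<open>[I, I]\<close>, so they descend the derived series of the radical to zero.
\<close>

section \<open>Traces and generalised eigenspaces of endomorphisms\<close>

text \<open>The Killing form alone would settle only semisimple algebras. A perfect algebra such as
  the semidirect product of sl2 with its two-dimensional module has a nonzero solvable ideal on
  which the form vanishes, so products could survive there; this forces the descent and the proof
  that the radical is solvable. Conjugation is used because it is additive: weights of
  \<open>ad x\<close> add under the bracket, so scaling each weight space by the conjugate weight is
  again a derivation. This property takes the place of the usual construction of that operator as a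
  polynomial in \<open>ad x\<close>. The trace identity behind the nilpotency test is accessible
  only for \<open>x\<close> a bracket, which is why it is applied to the stable term of the derived
  series, where brackets span.\<close>

context finite_dimensional_vector_space
begin

sublocale endo: vector_space_pair scale scale ..

abbreviation lin :: "('b \<Rightarrow> 'b) \<Rightarrow> bool" where
  "lin f \<equiv> Vector_Spaces.linear scale scale f"

lemma linI:
  "(\<And>x y. f (x + y) = f x + f y) \<Longrightarrow> (\<And>c x. f (c *s x) = c *s f x) \<Longrightarrow> lin f"
  using vector_space_axioms by (simp add: Vector_Spaces.linear_iff)

lemma lin_comp: "lin f \<Longrightarrow> lin g \<Longrightarrow> lin (\<lambda>x. f (g x))"
  by (simp add: Vector_Spaces.linear_iff)

lemma lin_add: "lin f \<Longrightarrow> lin g \<Longrightarrow> lin (\<lambda>x. f x + g x)"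
  by (rule linI) (simp_all add: endo.linear_add endo.linear_scale algebra_simps)

lemma lin_sub: "lin f \<Longrightarrow> lin g \<Longrightarrow> lin (\<lambda>x. f x - g x)"
  by (rule linI) (simp_all add: endo.linear_add endo.linear_scale algebra_simps)

lemma lin_funpow: "lin f \<Longrightarrow> lin (f ^^ k)"
  by (induction k) (auto intro!: linI simp: endo.linear_add endo.linear_scale)

lemma span_insert_subspaceE:
  assumes "subspace H" "g \<in> span (insert x H)"
  obtains h c where "h \<in> H" "g = h + c *s x"
proof -
  have "span H = H" using assms(1) span_eq_iff by blast
  then obtain c where "g - c *s x \<in> H"
    using assms(2) unfolding span_breakdown_eq \<open>span H = H\<close> by blast
  then show thesis using that[of "g - c *s x" c] by simp
qed

section \<open>Traces in arbitrary bases\<close>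

definition basis_trace :: "'b set \<Rightarrow> ('b \<Rightarrow> 'b) \<Rightarrow> 'a" where
  "basis_trace C f = (\<Sum>b\<in>C. representation C (f b) b)"

abbreviation trace :: "('b \<Rightarrow> 'b) \<Rightarrow> 'a" where
  "trace \<equiv> basis_trace Basis"

lemma lin_expand:
  assumes "independent C" "span C = UNIV" "lin f"
  shows "f v = (\<Sum>b\<in>C. representation C v b *s f b)"
proof -
  have "v = (\<Sum>b\<in>C. representation C v b *s b)"
    using sum_representation_eq[of C v C] assms finiteI_independent by auto
  then have "f v = f (\<Sum>b\<in>C. representation C v b *s b)"
    by simp
  then show ?thesis
    by (simp add: endo.linear_sum[OF \<open>lin f\<close>] endo.linear_scale[OF \<open>lin f\<close>])
qed

lemma representation_expand:
  assumes "independent B" "span B = UNIV" "independent C" "span C = UNIV" "lin f"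
  shows "representation B (f v) x = (\<Sum>c\<in>C. representation C v c * representation B (f c) x)"
proof -
  have "representation B (f v) x = representation B (\<Sum>c\<in>C. representation C v c *s f c) x"
    using lin_expand[OF assms(3,4,5), of v] by simp
  then show ?thesis
    using assms(1,2) by (simp add: representation_sum representation_scale)
qed

text \<open>Expanding \<open>b\<close> in the standard basis and swapping the sums contracts the
  \<open>B\<close>-coordinates away. Later traces are read off in bases adapted to kernels of powers
  or to generalised eigenspaces.\<close>

lemma basis_trace_eq:
  assumes "independent B" "span B = UNIV" "lin f"
  shows "basis_trace B f = trace f"
proof -
  have l: "lin (\<lambda>x. x)" by (rule linI) auto
  have "basis_trace B f = (\<Sum>b\<in>B. \<Sum>c\<in>Basis. representation Basis b c * representation B (f c) b)"
    unfolding basis_trace_def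
    by (rule sum.cong) (auto intro!: representation_expand assms independent_Basis span_Basis)
  also have "\<dots> = (\<Sum>c\<in>Basis. \<Sum>b\<in>B. representation B (f c) b * representation Basis b c)"
    by (subst sum.swap) (simp add: mult.commute)
  also have "\<dots> = (\<Sum>c\<in>Basis. representation Basis (f c) c)"
    by (intro sum.cong refl representation_expand[OF independent_Basis span_Basis assms(1,2) l, symmetric])
  finally show ?thesis unfolding basis_trace_def .
qed

lemma trace_comp_commute:
  assumes "lin f" "lin g"
  shows "trace (\<lambda>x. f (g x)) = trace (\<lambda>x. g (f x))"
proof -
  let ?R = "representation Basis"
  have e: "trace (\<lambda>x. f (g x)) = (\<Sum>b\<in>Basis. \<Sum>c\<in>Basis. ?R (g b) c * ?R (f c) b)" if "lin f" for f g
    unfolding basis_trace_def using that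
    by (intro sum.cong refl representation_expand independent_Basis span_Basis)
  show ?thesis
    unfolding e[OF assms(1)] e[OF assms(2)] by (subst sum.swap) (simp add: mult.commute)
qed

lemma trace_add: "trace (\<lambda>x. f x + g x) = trace f + trace g"
  by (simp add: basis_trace_def representation_add independent_Basis span_Basis sum.distrib)

lemma trace_diff: "trace (\<lambda>x. f x - g x) = trace f - trace g"
  by (simp add: basis_trace_def representation_diff independent_Basis span_Basis sum_subtractf)

lemma trace_scale: "trace (\<lambda>x. c *s f x) = c * trace f"
  by (simp add: basis_trace_def representation_scale independent_Basis span_Basis sum_distrib_left)

lemma trace_zero: "trace (\<lambda>x. 0) = 0"
  by (simp add: basis_trace_def representation_zero)

text \<open>The exponent may vary over \<open>S\<close>, but a basis chosen inside \<open>S\<close>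
  is finite, so a single exponent serves all of it.\<close>

lemma locally_nilpotent_imp_nilpotent:
  assumes f: "lin f" and nil: "\<And>b. b \<in> S \<Longrightarrow> \<exists>k. (f ^^ k) b = 0" and S: "span S = UNIV"
  shows "\<exists>k. \<forall>v. (f ^^ k) v = 0"
proof -
  obtain C where C: "C \<subseteq> S" "independent C" "S \<subseteq> span C"
    using maximal_independent_subset[of S] by auto
  have sC: "span C = UNIV"
    using span_mono[OF C(3)] S by (simp add: span_span top.extremum_unique)
  obtain k where k: "\<And>b. b \<in> C \<Longrightarrow> (f ^^ k b) b = 0"
    using nil C(1) by (metis subsetD)
  define n where "n = sum k C"
  have fin: "finite C" using C finiteI_independent by auto
  have z: "(f ^^ m) 0 = 0" for m
    using lin_funpow[OF f] endo.linear_0 by blast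
  have "(f ^^ n) b = 0" if "b \<in> C" for b
  proof -
    have "k b \<le> n" unfolding n_def using fin that by (simp add: member_le_sum)
    then have "(f ^^ n) b = (f ^^ (n - k b)) ((f ^^ k b) b)"
      using funpow_add[of "n - k b" "k b" f] by simp
    then show ?thesis using k[OF that] z by simp
  qed
  then have "(f ^^ n) v = 0" for v
    using lin_expand[OF C(2) sC lin_funpow[OF f, of n], of v] by simp
  then show ?thesis by blast
qed

text \<open>A basis adapted to the flag of the kernels of the powers of \<open>f\<close> makes the matrix of \<open>f\<close>
  strictly triangular.\<close>

lemma trace_nilpotent:
  assumes f: "lin f" and nil: "\<And>v. (f ^^ n) v = 0"
  shows "trace f = 0"
proof -
  have "\<exists>B. independent B \<and> span B = {v. (f ^^ k) v = 0} \<and> (\<forall>b\<in>B. representation B (f b) b = 0)" for k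
  proof (induction k)
    case 0
    show ?case by (rule exI[of _ "{}"]) (auto simp: independent_empty)
  next
    case (Suc k)
    then obtain B where B: "independent B" "span B = {v. (f ^^ k) v = 0}"
      "\<forall>b\<in>B. representation B (f b) b = 0" by auto
    let ?K = "{v. (f ^^ Suc k) v = 0}"
    have fz: "f 0 = 0" using endo.linear_0[OF f] .
    have "B \<subseteq> ?K"
    proof
      fix b assume "b \<in> B"
      then have "(f ^^ k) b = 0" using B(2) span_base by auto
      then show "b \<in> ?K" using fz by simp
    qed
    then obtain C where C: "B \<subseteq> C" "C \<subseteq> ?K" "independent C" "?K \<subseteq> span C"
      using maximal_independent_subset_extend[OF _ B(1)] by blast
    have "subspace ?K" by (rule endo.linear_subspace_kernel[OF lin_funpow[OF f]])
    then have sC: "span C = ?K" using C span_minimal by blast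
    have "representation C (f b) b = 0" if "b \<in> C" for b
    proof -
      have "(f ^^ k) (f b) = 0" using that C(2) by (auto simp: funpow_swap1)
      then have "f b \<in> span B" using B(2) by simp
      then have e: "representation C (f b) = representation B (f b)"
        using representation_extend[OF C(3) _ C(1)] by auto
      \<comment> \<open>A nonzero coordinate at \<open>b\<close> would put \<open>b\<close> into
        \<open>B\<close>, where the induction hypothesis excludes it.\<close>
      show ?thesis
        using B(3) e representation_ne_zero[of B "f b" b] by auto
    qed
    then show ?case using C(3) sC by blast
  qed
  from this[of n] obtain B where B: "independent B" "span B = UNIV"
      "\<forall>b\<in>B. representation B (f b) b = 0" using nil by auto
  have "basis_trace B f = 0" using B(3) by (simp add: basis_trace_def)
  then show ?thesis using basis_trace_eq[OF B(1,2) f] by simp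
qed

section \<open>Annihilating polynomials of a single vector\<close>

lemma nontrivial_relation:
  fixes u :: "nat \<Rightarrow> 'b"
  shows "\<exists>c. (\<exists>i\<le>dimension. c i \<noteq> 0) \<and> (\<Sum>i\<le>dimension. c i *s u i) = 0"
proof (cases "inj_on u {..dimension}")
  case True
  have "card (u ` {..dimension}) = Suc dimension"
    using True by (simp add: card_image)
  then have "dependent (u ` {..dimension})"
    using independent_card_le_dim[of "u ` {..dimension}" UNIV] dim_UNIV
    by (auto simp: dimension_def)
  then obtain c where c: "\<exists>v\<in>u ` {..dimension}. c v \<noteq> 0" "(\<Sum>v\<in>u ` {..dimension}. c v *s v) = 0"
    using dependent_finite[of "u ` {..dimension}"] by auto
  show ?thesis
    using c True by (intro exI[of _ "c \<circ> u"]) (auto simp: sum.reindex)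
next
  case False
  then obtain i j where ij: "i \<le> dimension" "j \<le> dimension" "i \<noteq> j" "u i = u j"
    by (auto simp: inj_on_def)
  \<comment> \<open>Repeated vectors collapse in the image set, so its dependence cannot be used;
    the relation is \<open>u i - u j = 0\<close>.\<close>
  let ?c = "\<lambda>k. if k = i then 1 else if k = j then - 1 else 0"
  have "(\<Sum>k\<le>dimension. ?c k *s u k) = (\<Sum>k\<in>{i,j}. ?c k *s u k)"
    using ij by (intro sum.mono_neutral_right) auto
  also have "\<dots> = 0" using ij by simp
  finally show ?thesis using ij by (intro exI[of _ ?c]) auto
qed

text \<open>Horner evaluation of \<open>q(f)\<close> at the vector \<open>v\<close>.\<close>

definition poly_op :: "('b \<Rightarrow> 'b) \<Rightarrow> 'a poly \<Rightarrow> 'b \<Rightarrow> 'b" where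
  "poly_op f q v = fold_coeffs (\<lambda>a w. a *s v + f w) q 0"

lemma poly_op_0 [simp]: "poly_op f 0 v = 0"
  by (simp add: poly_op_def)

lemma poly_op_pCons [simp]:
  assumes "lin f" shows "poly_op f (pCons a q) v = a *s v + f (poly_op f q v)"
  by (cases "q = 0 \<and> a = 0") (auto simp: poly_op_def endo.linear_0[OF assms])

lemma poly_op_add: "lin f \<Longrightarrow> poly_op f (p + q) v = poly_op f p v + poly_op f q v"
  by (induction p q rule: poly_induct2) (auto simp: endo.linear_add algebra_simps)

lemma poly_op_smult: "lin f \<Longrightarrow> poly_op f (smult c p) v = c *s poly_op f p v"
  by (induction p) (auto simp: endo.linear_scale algebra_simps)

lemma poly_op_sum: "lin f \<Longrightarrow> poly_op f (sum p I) v = (\<Sum>i\<in>I. poly_op f (p i) v)"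
  by (induction I rule: infinite_finite_induct) (auto simp: poly_op_add)

lemma poly_op_monom: "lin f \<Longrightarrow> poly_op f (monom c k) v = c *s (f ^^ k) v"
  by (induction k) (auto simp: monom_0 monom_Suc endo.linear_scale endo.linear_0)

lemma ex_annihilating_poly:
  assumes "lin f"
  shows "\<exists>q. q \<noteq> 0 \<and> poly_op f q v = 0"
proof -
  obtain c where c: "\<exists>i\<le>dimension. c i \<noteq> 0" "(\<Sum>i\<le>dimension. c i *s (f ^^ i) v) = 0"
    using nontrivial_relation[of "\<lambda>i. (f ^^ i) v"] by auto
  let ?q = "\<Sum>i\<le>dimension. monom (c i) i"
  obtain i where i: "i \<le> dimension" "c i \<noteq> 0" using c by auto
  have "coeff ?q i = c i" using i by (simp add: coeff_sum)
  then have "?q \<noteq> 0" using i by (metis coeff_0)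
  moreover have "poly_op f ?q v = 0"
    using c(2) assms by (simp add: poly_op_sum poly_op_monom)
  ultimately show ?thesis by blast
qed

section \<open>Generalised eigenspaces\<close>

definition shift :: "('b \<Rightarrow> 'b) \<Rightarrow> 'a \<Rightarrow> 'b \<Rightarrow> 'b" where
  "shift f c v = f v - c *s v"

definition geigen :: "('b \<Rightarrow> 'b) \<Rightarrow> 'a \<Rightarrow> 'b set" where
  "geigen f c = {v. \<exists>k. (shift f c ^^ k) v = 0}"

lemma lin_shift: "lin f \<Longrightarrow> lin (shift f c)"
  by (rule linI) (auto simp: shift_def endo.linear_add endo.linear_scale algebra_simps)

lemma shift_commute: "lin f \<Longrightarrow> shift f c (shift f d v) = shift f d (shift f c v)"
  by (simp add: shift_def endo.linear_diff endo.linear_scale algebra_simps)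

lemma shift_funpow_commute:
  "lin f \<Longrightarrow> (shift f c ^^ k) (shift f d v) = shift f d ((shift f c ^^ k) v)"
  by (induction k) (auto simp: shift_commute)

lemma geigen_subspace:
  assumes "lin f" shows "subspace (geigen f c)"
proof (rule subspaceI)
  note l = lin_funpow[OF lin_shift[OF assms]]
  have z: "(shift f c ^^ k) 0 = 0" for k using l endo.linear_0 by blast
  show "0 \<in> geigen f c" using z by (auto simp: geigen_def)
  fix x y a assume "x \<in> geigen f c" 
  then obtain i where i: "(shift f c ^^ i) x = 0" by (auto simp: geigen_def)
  show "a *s x \<in> geigen f c"
    using i by (auto simp: geigen_def endo.linear_scale[OF l])
  assume "y \<in> geigen f c"
  then obtain j where j: "(shift f c ^^ j) y = 0" by (auto simp: geigen_def)
  have "(shift f c ^^ (j + i)) x = 0" using i z by (simp add: funpow_add)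
  moreover have "(shift f c ^^ (i + j)) y = 0" using j z by (simp add: funpow_add)
  ultimately have "(shift f c ^^ (i + j)) (x + y) = 0"
    by (simp add: endo.linear_add[OF l] add.commute)
  then show "x + y \<in> geigen f c" by (auto simp: geigen_def)
qed

lemma shift_geigen:
  assumes "lin f" "v \<in> geigen f c" shows "shift f d v \<in> geigen f c"
proof -
  obtain k where "(shift f c ^^ k) v = 0" using assms(2) by (auto simp: geigen_def)
  then have "(shift f c ^^ k) (shift f d v) = 0"
    using shift_funpow_commute[OF assms(1)] endo.linear_0[OF lin_shift[OF assms(1)]] by simp
  then show ?thesis unfolding geigen_def by blast
qed

text \<open>On this space \<open>shift f d\<close> is the nonzero scalar \<open>c - d\<close> plus a
  locally nilpotent map, hence invertible; induction on the exponent replaces the geometric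
  series.\<close>

lemma shift_geigen_surj:
  assumes "lin f" "w \<in> geigen f c" "c \<noteq> d"
  shows "\<exists>u\<in>geigen f c. shift f d u = w"
proof -
  have "\<exists>u\<in>geigen f c. shift f d u = w" if "(shift f c ^^ k) w = 0" for k
    using that
  proof (induction k arbitrary: w)
    case 0
    then show ?case
      using subspace_0[OF geigen_subspace[OF assms(1)]] endo.linear_0[OF lin_shift[OF assms(1)]] by auto
  next
    case (Suc k)
    then have "(shift f c ^^ k) (shift f c w) = 0" by (simp add: funpow_swap1)
    from Suc.IH[OF this] obtain u where u: "u \<in> geigen f c" "shift f d u = shift f c w" by auto
    have w: "w \<in> geigen f c" using Suc.prems unfolding geigen_def by blast
    \<comment> \<open>By the choice of \<open>u\<close>, applying \<open>shift f d\<close> to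
      \<open>w - u\<close> gives \<open>shift f d w - shift f c w\<close>, a nonzero multiple of
      \<open>w\<close>.\<close>
    let ?v = "inverse (c - d) *s (w - u)"
    have "shift f d ?v = inverse (c - d) *s (shift f d w - shift f c w)"
      using u lin_shift[OF assms(1)] by (simp add: endo.linear_scale endo.linear_diff)
    also have "shift f d w - shift f c w = (c - d) *s w"
      by (simp add: shift_def algebra_simps)
    finally have "shift f d ?v = w" using assms(3) by simp
    moreover have "?v \<in> geigen f c"
      using geigen_subspace[OF assms(1)] w u by (simp add: subspace_scale subspace_diff)
    ultimately show ?case by blast
  qed
  then show ?thesis using assms(2) by (auto simp: geigen_def)
qed

text \<open>This cancels a linear factor. Components for eigenvalues other than \<open>d\<close> lie
  in the image of \<open>shift f d\<close>; subtracting a preimage \<open>u\<close> of them leaves a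
  vector in the generalised eigenspace of \<open>d\<close>, so \<open>v - u\<close> lies there too,
  one power higher.\<close>

lemma shift_span_geigen:
  assumes f: "lin f" and v: "shift f d v \<in> span (\<Union>c. geigen f c)"
  shows "v \<in> span (\<Union>c. geigen f c)"
proof -
  let ?W = "span (\<Union>c. geigen f c)"
  have "\<exists>u\<in>?W. \<exists>w\<in>geigen f d. shift f d u + w = x" if "x \<in> ?W" for x
    using that
  proof (induction rule: span_induct_alt)
    case base
    show ?case
      using subspace_0[OF geigen_subspace[OF f]] endo.linear_0[OF lin_shift[OF f]]
      by (auto intro!: bexI[of _ 0] span_zero)
  next
    case (step a x y)
    then obtain u w where uw: "u \<in> ?W" "w \<in> geigen f d" "shift f d u + w = y" by auto
    from step obtain c where c: "x \<in> geigen f c" by auto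
    show ?case
    proof (cases "c = d")
      case True
      then have "a *s x + w \<in> geigen f d"
        using c uw geigen_subspace[OF f] by (simp add: subspace_scale subspace_add)
      moreover have "shift f d u + (a *s x + w) = a *s x + y" using uw by (simp add: algebra_simps)
      ultimately show ?thesis using uw(1) by blast
    next
      case False
      then obtain u' where u': "u' \<in> geigen f c" "shift f d u' = x"
        using shift_geigen_surj[OF f c] by auto
      have "a *s u' + u \<in> ?W" using u' uw by (auto intro!: span_add span_scale intro: span_base)
      moreover have "shift f d (a *s u' + u) + w = a *s x + y"
        using uw u' lin_shift[OF f] by (simp add: endo.linear_add endo.linear_scale algebra_simps)
      ultimately show ?thesis using uw(2) by blast
    qed
  qed
  from this[OF v] obtain u w where uw: "u \<in> ?W" "w \<in> geigen f d" "shift f d u + w = shift f d v"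
    by auto
  obtain k where k: "(shift f d ^^ k) w = 0" using uw(2) by (auto simp: geigen_def)
  have "shift f d (v - u) = w" using uw lin_shift[OF f] by (simp add: endo.linear_diff algebra_simps)
  then have "(shift f d ^^ Suc k) (v - u) = 0" using k by (simp add: funpow_swap1)
  then have "v - u \<in> geigen f d" unfolding geigen_def by blast
  then have "v - u \<in> ?W" by (auto intro: span_base)
  from span_add[OF this uw(1)] show ?thesis by simp
qed

lemma geigen_inter:
  assumes f: "lin f" and v: "v \<in> geigen f c" "shift f d v = 0" and "c \<noteq> d"
  shows "v = 0"
proof -
  obtain k where k: "(shift f c ^^ k) v = 0" using v by (auto simp: geigen_def)
  have "shift f c v = (d - c) *s v" using v(2) by (simp add: shift_def algebra_simps)
  then have "(shift f c ^^ m) v = (d - c) ^ m *s v" for m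
    by (induction m) (auto simp: endo.linear_scale[OF lin_shift[OF f]] mult.commute)
  then show ?thesis using k \<open>c \<noteq> d\<close> by simp
qed

lemma geigen_inter_funpow:
  assumes f: "lin f" and "v \<in> geigen f c" "(shift f d ^^ k) v = 0" and "c \<noteq> d"
  shows "v = 0"
  using assms(2,3)
proof (induction k arbitrary: v)
  case (Suc k)
  then have "shift f d v = 0"
    using Suc.IH[of "shift f d v"] shift_geigen[OF f Suc.prems(1)] by (simp add: funpow_swap1)
  then show ?case using geigen_inter[OF f Suc.prems(1)] \<open>c \<noteq> d\<close> by blast
qed simp

text \<open>A power of \<open>shift f d\<close> kills the \<open>d\<close> component, keeps the
  others in their eigenspaces and is injective on those.\<close>

lemma geigen_independent:
  assumes f: "lin f" and "finite F" "\<And>c. c \<in> F \<Longrightarrow> v c \<in> geigen f c" "(\<Sum>c\<in>F. v c) = 0"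
  shows "\<forall>c\<in>F. v c = 0"
  using assms(2-)
proof (induction F arbitrary: v rule: finite_induct)
  case (insert d F)
  obtain k where k: "(shift f d ^^ k) (v d) = 0" using insert.prems by (auto simp: geigen_def)
  let ?w = "\<lambda>c. (shift f d ^^ k) (v c)"
  have "?w c \<in> geigen f c" if "c \<in> F" for c
  proof -
    have "(shift f d ^^ m) (v c) \<in> geigen f c" for m
      by (induction m) (use insert.prems that shift_geigen[OF f] in auto)
    then show ?thesis .
  qed
  moreover have "(\<Sum>c\<in>F. ?w c) = 0"
  proof -
    note l = lin_funpow[OF lin_shift[OF f, of d], of k]
    have "0 = (shift f d ^^ k) (\<Sum>c\<in>insert d F. v c)"
      using insert.prems endo.linear_0[OF l] by simp
    also have "\<dots> = (\<Sum>c\<in>F. ?w c)"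
      using insert.hyps k by (simp add: endo.linear_add[OF l] endo.linear_sum[OF l])
    finally show ?thesis by simp
  qed
  ultimately have "\<forall>c\<in>F. ?w c = 0" by (rule insert.IH)
  then have "\<forall>c\<in>F. v c = 0"
    using geigen_inter_funpow[OF f] insert.prems(1) insert.hyps by (metis insertCI)
  then show ?case using insert by simp
qed simp

end

section \<open>Complex scalars: eigenspace decomposition and a trace test for nilpotency\<close>

locale complex_vector_space = finite_dimensional_vector_space sc Basis
  for sc :: "complex \<Rightarrow> 'a::ab_group_add \<Rightarrow> 'a" and Basis
begin

text \<open>Algebraic closedness enters here: a root \<open>r\<close> of \<open>q\<close> splits off
  \<open>shift f r\<close>, which \<open>shift_span_geigen\<close> cancels, until only a nonzero
  constant remains.\<close>

lemma poly_op_in_span_geigen: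
  assumes f: "lin f" and "q \<noteq> 0" "poly_op f q v \<in> span (\<Union>c. geigen f c)"
  shows "v \<in> span (\<Union>c. geigen f c)"
  using assms(2,3)
proof (induction "degree q" arbitrary: q rule: less_induct)
  case less
  show ?case
  proof (cases "degree q = 0")
    case True
    then obtain a where a: "q = [:a:]" by (meson degree_eq_zeroE)
    then have "sc a v \<in> span (\<Union>c. geigen f c)"
      using less.prems f by (simp add: endo.linear_0)
    from span_scale[OF this, of "inverse a"] show ?thesis using a less.prems by simp
  next
    case False
    then obtain r where r: "poly q r = 0" using alg_closed_imp_poly_has_root by blast
    then obtain p where p: "q = [:- r, 1:] * p" by (auto simp: poly_eq_0_iff_dvd)
    then have "p \<noteq> 0" using less.prems by auto
    then have "degree p < degree q" unfolding p by (subst degree_mult_eq) auto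
    moreover have "poly_op f q v = shift f r (poly_op f p v)"
      unfolding p using f poly_op_add[OF f, of "smult (- r) p" "pCons 0 p"]
      by (simp add: poly_op_smult shift_def algebra_simps del: smult_minus_left)
    ultimately show ?thesis
      using less \<open>p \<noteq> 0\<close> shift_span_geigen[OF f] by metis
  qed
qed

lemma span_geigen:
  assumes "lin f" shows "span (\<Union>c. geigen f c) = UNIV"
proof -
  have "v \<in> span (\<Union>c. geigen f c)" for v
    using ex_annihilating_poly[OF assms, of v] poly_op_in_span_geigen[OF assms, of _ v] span_zero by metis
  then show ?thesis by blast
qed

lemma geigen_basis:
  assumes "lin f"
  obtains B ev where "independent B" "span B = UNIV" "finite B" "\<And>b. b \<in> B \<Longrightarrow> b \<in> geigen f (ev b)"
proof -
  obtain B where B: "B \<subseteq> (\<Union>c. geigen f c)" "independent B" "(\<Union>c. geigen f c) \<subseteq> span B"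
    using maximal_independent_subset by blast
  have "span B = UNIV"
    using span_mono[OF B(3)] span_geigen[OF assms] by (simp add: span_span top.extremum_unique)
  moreover from B(1) obtain ev where "\<And>b. b \<in> B \<Longrightarrow> b \<in> geigen f (ev b)"
    by (metis UN_iff subsetD)
  ultimately show thesis using that B(2) finiteI_independent by blast
qed

text \<open>The identity as \<open>\<chi>\<close> yields the semisimple part of \<open>f\<close>,
  and \<open>cnj\<close> its conjugate. As \<open>E\<close> is defined through a basis, the work is
  to see that it scales every generalised eigenvector, not only the basis vectors.\<close>

lemma ex_geigen_scaling:
  fixes \<chi> :: "complex \<Rightarrow> complex"
  assumes f: "lin f"
  shows "\<exists>E. lin E \<and> (\<forall>c. \<forall>v\<in>geigen f c. E v = sc (\<chi> c) v)"
proof -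
  obtain B ev where B: "independent B" "span B = UNIV" "finite B" "\<And>b. b \<in> B \<Longrightarrow> b \<in> geigen f (ev b)"
    using geigen_basis[OF f] by metis
  define E where "E v = (\<Sum>b\<in>B. sc (\<chi> (ev b)) (sc (representation B v b) b))" for v
  have "lin E"
    by (rule linI)
       (simp_all add: E_def B representation_add representation_scale algebra_simps sum.distrib
         scale_sum_right)
  moreover have "E v = sc (\<chi> c) v" if v: "v \<in> geigen f c" for c v
  proof -
    \<comment> \<open>\<open>c\<close> need not be among the values \<open>ev b\<close>; inserting
      it also covers a trivial eigenspace.\<close>
    define F where "F = insert c (ev ` B)"
    have F: "finite F" "ev ` B \<subseteq> F" using B by (auto simp: F_def)
    define w where "w d = (\<Sum>b\<in>{b\<in>B. ev b = d}. sc (representation B v b) b)" for d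
    have w: "w d \<in> geigen f d" for d
      unfolding w_def
      by (rule subspace_sum[OF geigen_subspace[OF f]])
        (use B(4) subspace_scale[OF geigen_subspace[OF f]] in blast)
    have "v = (\<Sum>b\<in>B. sc (representation B v b) b)"
      using sum_representation_eq[of B v B] B by auto
    also have "\<dots> = (\<Sum>d\<in>F. w d)"
      unfolding w_def by (rule sum.group[symmetric]) (use B F in auto)
    finally have vw: "v = (\<Sum>d\<in>F. w d)" .
    \<comment> \<open>Moving \<open>v\<close> to the other side gives a relation between distinct
      eigenspaces; independence then leaves only the \<open>c\<close> component.\<close>
    have "(\<Sum>d\<in>F. w d - (if d = c then v else 0)) = 0"
      using F vw by (simp add: sum_subtractf F_def)
    moreover have "w d - (if d = c then v else 0) \<in> geigen f d" for d
      using w v geigen_subspace[OF f] by (auto simp: subspace_diff)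
    ultimately have "\<forall>d\<in>F. w d - (if d = c then v else 0) = 0"
      by (intro geigen_independent[OF f F(1)])
    then have weq: "w d = (if d = c then v else 0)" if "d \<in> F" for d using that by simp
    have "E v = (\<Sum>d\<in>F. \<Sum>b\<in>{b\<in>B. ev b = d}. sc (\<chi> (ev b)) (sc (representation B v b) b))"
      unfolding E_def by (rule sum.group[symmetric]) (use B F in auto)
    also have "\<dots> = (\<Sum>d\<in>F. sc (\<chi> d) (w d))"
      unfolding w_def scale_sum_right by (intro sum.cong) auto
    also have "\<dots> = (\<Sum>d\<in>F. if d = c then sc (\<chi> c) v else 0)"
      by (rule sum.cong) (auto simp: weq)
    also have "\<dots> = sc (\<chi> c) v" using F by (simp add: F_def)
    finally show ?thesis .
  qed
  ultimately show ?thesis by blast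
qed

text \<open>Writing \<open>f = S + N\<close> with \<open>S\<close> the semisimple part, \<open>E N\<close> is nilpotent and \<open>E S\<close> has trace
  \<open>\<Sum> \<bar>\<lambda>\<bar>\<^sup>2\<close>, summed over the eigenvalues of \<open>f\<close>.\<close>

lemma nilpotent_if_trace_cnj_zero:
  assumes f: "lin f" and E: "lin E" "\<And>c v. v \<in> geigen f c \<Longrightarrow> E v = sc (cnj c) v"
    and tr: "trace (\<lambda>v. E (f v)) = 0"
  shows "\<exists>k. \<forall>v. (f ^^ k) v = 0"
proof -
  obtain B ev where B: "independent B" "span B = UNIV" "finite B" "\<And>b. b \<in> B \<Longrightarrow> b \<in> geigen f (ev b)"
    using geigen_basis[OF f] by metis
  obtain S where S: "lin S" "\<And>c v. v \<in> geigen f c \<Longrightarrow> S v = sc c v"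
    using ex_geigen_scaling[OF f, of "\<lambda>c. c"] by auto
  define M where "M v = E (f v - S v)" for v
  have M: "lin M" unfolding M_def by (intro lin_comp[OF E(1)] lin_sub f S)
  \<comment> \<open>On the eigenspace of \<open>c\<close>, \<open>f - S\<close> is
    \<open>shift f c\<close> and \<open>E\<close> is the scalar \<open>cnj c\<close>, so
    \<open>M\<close> inherits local nilpotency.\<close>
  have Mpow: "(M ^^ k) v = sc (cnj c ^ k) ((shift f c ^^ k) v)" if v: "v \<in> geigen f c" for k v c
  proof (induction k)
    case (Suc k)
    let ?u = "(shift f c ^^ k) v"
    have u: "?u \<in> geigen f c"
      by (induction k) (use v shift_geigen[OF f] in auto)
    have "M ?u = E (shift f c ?u)" by (simp add: M_def S(2)[OF u] shift_def)
    also have "\<dots> = sc (cnj c) (shift f c ?u)" by (rule E(2)[OF shift_geigen[OF f u]])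
    finally show ?case using Suc by (simp add: endo.linear_scale[OF M] mult.commute)
  qed simp
  have "\<exists>k. \<forall>v. (M ^^ k) v = 0"
  proof (rule locally_nilpotent_imp_nilpotent[OF M _ span_geigen[OF f]])
    fix b assume "b \<in> (\<Union>c. geigen f c)"
    then obtain c where c: "b \<in> geigen f c" by auto
    then obtain k where "(shift f c ^^ k) b = 0" by (auto simp: geigen_def)
    then show "\<exists>k. (M ^^ k) b = 0" using Mpow[OF c, of k] by (intro exI[of _ k]) simp
  qed
  then have "trace M = 0" using trace_nilpotent[OF M] by blast
  moreover have "trace (\<lambda>v. E (S v) + M v) = 0"
    using tr by (simp add: M_def endo.linear_diff[OF E(1)])
  ultimately have "trace (\<lambda>v. E (S v)) = 0" by (simp add: trace_add)
  then have "basis_trace B (\<lambda>v. E (S v)) = 0"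
    using basis_trace_eq[OF B(1,2) lin_comp[OF E(1) S(1)]] by simp
  moreover have "representation B (E (S b)) b = complex_of_real ((cmod (ev b))\<^sup>2)" if b: "b \<in> B" for b
  proof -
    have "E (S b) = sc (ev b * cnj (ev b)) b"
      by (simp add: S(2)[OF B(4)[OF b]] endo.linear_scale[OF E(1)] E(2)[OF B(4)[OF b]])
    then show ?thesis
      using B b complex_norm_square[of "ev b"] by (simp add: representation_scale representation_basis)
  qed
  ultimately have "complex_of_real (\<Sum>b\<in>B. (cmod (ev b))\<^sup>2) = 0"
    by (simp add: basis_trace_def)
  then have "(\<Sum>b\<in>B. (cmod (ev b))\<^sup>2) = 0" by (simp only: of_real_eq_0_iff)
  \<comment> \<open>The summands are nonnegative reals, so none can be cancelled by the
    others.\<close>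
  then have ev0: "ev b = 0" if "b \<in> B" for b
    using that B(3) by (simp add: sum_nonneg_eq_0_iff)
  have sh0: "shift f 0 = f" by (simp add: shift_def fun_eq_iff)
  show ?thesis
  proof (rule locally_nilpotent_imp_nilpotent[OF f _ B(2)])
    fix b assume "b \<in> B"
    then have "b \<in> geigen f 0" using B(4) ev0 by metis
    then show "\<exists>k. (f ^^ k) b = 0" by (simp add: geigen_def sh0)
  qed
qed

end

section \<open>Lie algebras, derivations and Engel's theorem\<close>

locale complex_lie_algebra = complex_vector_space sc Basis
  for sc :: "complex \<Rightarrow> 'a::ab_group_add \<Rightarrow> 'a" and Basis +
  fixes br :: "'a \<Rightarrow> 'a \<Rightarrow> 'a"
  assumes lie: "lie_algebra sc br"
begin

lemma lin_br: "lin (br x)"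
  and lin_br_left: "lin (\<lambda>x. br x y)"
  and br_self [simp]: "br x x = 0"
  and jacobi_cyclic: "br x (br y z) + br y (br z x) + br z (br x y) = 0"
  using lie unfolding lie_algebra_def by blast+

lemmas br_simps = endo.linear_add[OF lin_br] endo.linear_add[OF lin_br_left]
  endo.linear_scale[OF lin_br] endo.linear_scale[OF lin_br_left]
  endo.linear_diff[OF lin_br] endo.linear_diff[OF lin_br_left]
  endo.linear_neg[OF lin_br] endo.linear_neg[OF lin_br_left]
  endo.linear_0[OF lin_br] endo.linear_0[OF lin_br_left]

lemma br_anti: "br y x = - br x y"
proof -
  have "br (x + y) (x + y) = br x y + br y x"
    unfolding endo.linear_add[OF lin_br] endo.linear_add[OF lin_br_left] by simp
  then show ?thesis by (simp add: add_eq_0_iff add.commute)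
qed

lemma jacobi: "br x (br y z) = br (br x y) z + br y (br x z)"
proof -
  have "br y (br z x) = - br y (br x z)" "br z (br x y) = - br (br x y) z"
    using br_anti br_simps by metis+
  then show ?thesis using jacobi_cyclic[of x y z] by (simp add: algebra_simps)
qed

section \<open>Derivations, bracket spans and weights\<close>

definition derivation :: "('a \<Rightarrow> 'a) \<Rightarrow> bool" where
  "derivation f \<longleftrightarrow> lin f \<and> (\<forall>x y. f (br x y) = br (f x) y + br x (f y))"

lemma derivation_br: "derivation (br x)"
  unfolding derivation_def using jacobi lin_br by blast

text \<open>Partial application lets \<open>(bracket_span H ^^ k) UNIV\<close> denote the k-th term
  of the series obtained by bracketing the whole algebra with \<open>H\<close>; its reaching zero
  says that \<open>H\<close> acts nilpotently.\<close>

definition bracket_span :: "'a set \<Rightarrow> 'a set \<Rightarrow> 'a set" where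
  "bracket_span A B = span {br a b | a b. a \<in> A \<and> b \<in> B}"

lemma bracket_spanI: "a \<in> A \<Longrightarrow> b \<in> B \<Longrightarrow> br a b \<in> bracket_span A B"
  unfolding bracket_span_def by (rule span_base) blast

lemma bracket_span_least:
  "subspace V \<Longrightarrow> (\<And>a b. a \<in> A \<Longrightarrow> b \<in> B \<Longrightarrow> br a b \<in> V) \<Longrightarrow> bracket_span A B \<subseteq> V"
  unfolding bracket_span_def by (rule span_minimal) auto

lemma bracket_span_mono: "A \<subseteq> A' \<Longrightarrow> B \<subseteq> B' \<Longrightarrow> bracket_span A B \<subseteq> bracket_span A' B'"
  unfolding bracket_span_def by (rule span_mono) blast

lemma subspace_bracket_span: "subspace (bracket_span A B)"
  by (simp add: bracket_span_def)

lemma subspace_bracket_span_funpow: "subspace V \<Longrightarrow> subspace ((bracket_span H ^^ k) V)"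
  by (cases k) (auto simp: subspace_bracket_span)

lemma bracket_span_funpow_mono: "H \<subseteq> H' \<Longrightarrow> V \<subseteq> V' \<Longrightarrow> (bracket_span H ^^ k) V \<subseteq> (bracket_span H' ^^ k) V'"
  by (induction k) (simp_all add: bracket_span_mono)

lemma derivation_bracket_span:
  assumes "derivation f" "f ` A \<subseteq> A" "f ` B \<subseteq> B"
  shows "f ` bracket_span A B \<subseteq> bracket_span A B"
proof -
  have l: "lin f" using assms(1) by (simp add: derivation_def)
  have "bracket_span A B \<subseteq> {v. f v \<in> bracket_span A B}"
  proof (rule bracket_span_least)
    show "subspace {v. f v \<in> bracket_span A B}"
      using endo.linear_subspace_vimage[OF l subspace_bracket_span] by (simp add: vimage_def)
    show "br a b \<in> {v. f v \<in> bracket_span A B}" if "a \<in> A" "b \<in> B" for a b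
    proof -
      have "f (br a b) = br (f a) b + br a (f b)" using assms(1) by (simp add: derivation_def)
      moreover have "br (f a) b \<in> bracket_span A B" "br a (f b) \<in> bracket_span A B"
        using that assms by (auto intro!: bracket_spanI)
      ultimately show ?thesis by (simp add: subspace_add[OF subspace_bracket_span])
    qed
  qed
  then show ?thesis by blast
qed

text \<open>By the Leibniz rule, \<open>shift f (c + d)\<close> lowers the exponent of one factor at
  a time, hence the induction on the sum of both exponents.\<close>

lemma derivation_geigen:
  assumes f: "derivation f" and "x \<in> geigen f c" "y \<in> geigen f d"
  shows "br x y \<in> geigen f (c + d)"
proof -
  have lf: "lin f" using f by (simp add: derivation_def)
  have step: "shift f (c + d) (br x y) = br (shift f c x) y + br x (shift f d y)" for x y
    using f by (simp add: shift_def derivation_def br_simps algebra_simps)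
  have "br x y \<in> geigen f (c + d)" if "(shift f c ^^ i) x = 0" "(shift f d ^^ j) y = 0" for i j
    using that
  proof (induction "i + j" arbitrary: i j x y)
    case 0
    then show ?case using br_simps subspace_0[OF geigen_subspace[OF lf]] by simp
  next
    case (Suc n)
    note sub = geigen_subspace[OF lf]
    have "br (shift f c x) y \<in> geigen f (c + d)"
    proof (cases i)
      case 0
      then show ?thesis using Suc.prems br_simps subspace_0[OF sub] endo.linear_0[OF lin_shift[OF lf]] by simp
    next
      case (Suc i')
      then show ?thesis using Suc.hyps(1)[of i' j "shift f c x" y] Suc.hyps(2) Suc.prems
        by (simp add: funpow_swap1)
    qed
    moreover have "br x (shift f d y) \<in> geigen f (c + d)"
    proof (cases j)
      case 0
      then show ?thesis using Suc.prems br_simps subspace_0[OF sub] endo.linear_0[OF lin_shift[OF lf]] by simp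
    next
      case (Suc j')
      then show ?thesis using Suc.hyps(1)[of i j' x "shift f d y"] Suc.hyps(2) Suc.prems
        by (simp add: funpow_swap1)
    qed
    ultimately have "shift f (c + d) (br x y) \<in> geigen f (c + d)"
      unfolding step by (rule subspace_add[OF sub])
    then obtain k where "(shift f (c + d) ^^ k) (shift f (c + d) (br x y)) = 0"
      by (auto simp: geigen_def)
    then have "(shift f (c + d) ^^ Suc k) (br x y) = 0" by (simp add: funpow_swap1)
    then show ?case unfolding geigen_def by blast
  qed
  then show ?thesis using assms by (auto simp: geigen_def)
qed

text \<open>Since weights add under the bracket, additivity of \<open>\<chi>\<close> is the Leibniz
  rule on generalised eigenvectors. These span, and the defect \<open>?d\<close> is linear in each
  argument.\<close>

lemma derivation_geigen_scaling:
  assumes f: "derivation f" and E: "lin E" "\<And>c v. v \<in> geigen f c \<Longrightarrow> E v = sc (\<chi> c) v"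
    and \<chi>: "\<And>c d. \<chi> (c + d) = \<chi> c + \<chi> d"
  shows "derivation E"
proof -
  have lf: "lin f" using f by (simp add: derivation_def)
  let ?G = "\<Union>c. geigen f c"
  let ?d = "\<lambda>x y. E (br x y) - (br (E x) y + br x (E y))"
  have l1: "lin (\<lambda>y. ?d x y)" for x
    by (intro lin_sub lin_add lin_comp[OF E(1) lin_br] lin_comp[OF lin_br E(1)] lin_br)
  have l2: "lin (\<lambda>x. ?d x y)" for y
    by (intro lin_sub lin_add lin_comp[OF E(1) lin_br_left] lin_comp[OF lin_br_left E(1)] lin_br_left)
  have base: "?d x y = 0" if xy: "x \<in> geigen f c" "y \<in> geigen f d" for c d x y
    using E(2)[OF derivation_geigen[OF f xy]] E(2)[OF xy(1)] E(2)[OF xy(2)]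
    by (simp add: \<chi> br_simps scale_left_distrib)
  have 1: "?d x y = 0" if "x \<in> ?G" for x y
  proof (rule endo.linear_eq_0_on_span[OF l1])
    show "y \<in> span ?G" using span_geigen[OF lf] by simp
    show "?d x b = 0" if "b \<in> ?G" for b using base \<open>x \<in> ?G\<close> that by blast
  qed
  have "?d x y = 0" for x y
  proof (rule endo.linear_eq_0_on_span[OF l2])
    show "x \<in> span ?G" using span_geigen[OF lf] by simp
    show "?d b y = 0" if "b \<in> ?G" for b using 1 that by blast
  qed
  then show ?thesis using E(1) by (simp add: derivation_def)
qed

text \<open>Quantifying over all derivations hides the conjugate operator: a caller works with the
  Leibniz rule of \<open>E\<close> alone.\<close>

lemma derivation_nilpotent_if_trace_zero:
  assumes f: "derivation f" and tr: "\<And>E. derivation E \<Longrightarrow> trace (\<lambda>v. E (f v)) = 0"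
  shows "\<exists>k. \<forall>v. (f ^^ k) v = 0"
proof -
  have lf: "lin f" using f by (simp add: derivation_def)
  obtain E where E: "lin E" "\<And>c v. v \<in> geigen f c \<Longrightarrow> E v = sc (cnj c) v"
    using ex_geigen_scaling[OF lf, of cnj] by auto
  have "derivation E" by (rule derivation_geigen_scaling[OF f E]) auto
  from nilpotent_if_trace_cnj_zero[OF lf E tr[OF this]] show ?thesis .
qed

section \<open>Engel's theorem\<close>

text \<open>Every \<open>m\<close>-fold product of elements of \<open>H + \<complex>x\<close>, where \<open>(ad x)\<^sup>m = 0\<close>, descends one
  step in the lower series of \<open>H\<close>, since \<open>x\<close> preserves the steps of that series.\<close>

lemma bracket_nilpotent_extend:
  assumes H: "subspace H" and xH: "\<And>h. h \<in> H \<Longrightarrow> br x h \<in> H"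
    and n: "(bracket_span H ^^ n) UNIV = {0}" and m: "\<And>v. (br x ^^ m) v = 0"
  shows "\<exists>k. (bracket_span (span (insert x H)) ^^ k) UNIV = {0}"
proof -
  define W where "W j = (bracket_span H ^^ j) UNIV" for j
  define W' where "W' j = (bracket_span (span (insert x H)) ^^ j) UNIV" for j
  have W0: "W 0 = UNIV" and WS: "W (Suc j) = bracket_span H (W j)" for j by (simp_all add: W_def)
  have sW: "subspace (W j)" for j unfolding W_def by (intro subspace_bracket_span_funpow) simp
  have dec: "W (Suc j) \<subseteq> W j" for j
    by (induction j) (simp_all add: W0 WS bracket_span_mono)
  have stab: "br x ` W j \<subseteq> W j" for j
  proof (induction j)
    case (Suc j)
    then show ?case unfolding WS by (intro derivation_bracket_span derivation_br) (use xH in auto)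
  qed (simp add: W0)
  have stabp: "(br x ^^ i) w \<in> W j" if "w \<in> W j" for i j w
    by (induction i) (use that stab in auto)
  \<comment> \<open>\<open>T j i\<close> bounds what \<open>i\<close> brackets can make of
    \<open>W j\<close>: only choosing \<open>x\<close> every time can stay outside
    \<open>W (Suc j)\<close>, and this contributes \<open>(br x ^^ i) w\<close>.\<close>
  define T where "T j i = {(br x ^^ i) w + w' | w w'. w \<in> W j \<and> w' \<in> W (Suc j)}" for i j
  have sT: "subspace (T j i)" for i j
  proof (rule subspaceI)
    note l = lin_funpow[OF lin_br[of x], of i]
    have "0 = (br x ^^ i) 0 + 0" using endo.linear_0[OF l] by simp
    then show "0 \<in> T j i"
      unfolding T_def using subspace_0[OF sW] by blast
    show "u + v \<in> T j i" if uv: "u \<in> T j i" "v \<in> T j i" for u v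
    proof -
      obtain a a' b b' where "u = (br x ^^ i) a + a'" "v = (br x ^^ i) b + b'"
        "a \<in> W j" "b \<in> W j" "a' \<in> W (Suc j)" "b' \<in> W (Suc j)" using uv by (auto simp: T_def)
      then have "u + v = (br x ^^ i) (a + b) + (a' + b')" "a + b \<in> W j" "a' + b' \<in> W (Suc j)"
        by (auto simp: endo.linear_add[OF l] subspace_add[OF sW] algebra_simps)
      then show ?thesis unfolding T_def by blast
    qed
    show "sc c u \<in> T j i" if u: "u \<in> T j i" for c u
    proof -
      obtain a a' where "u = (br x ^^ i) a + a'" "a \<in> W j" "a' \<in> W (Suc j)" using u by (auto simp: T_def)
      then have "sc c u = (br x ^^ i) (sc c a) + sc c a'" "sc c a \<in> W j" "sc c a' \<in> W (Suc j)"
        by (auto simp: endo.linear_scale[OF l] subspace_scale[OF sW] algebra_simps)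
      then show ?thesis unfolding T_def by blast
    qed
  qed
  have step: "bracket_span (span (insert x H)) (T j i) \<subseteq> T j (Suc i)" for j i
  proof (rule bracket_span_least[OF sT])
    fix g t assume "g \<in> span (insert x H)" "t \<in> T j i"
    then obtain c h w w' where g: "g = h + sc c x" "h \<in> H"
      and t: "t = (br x ^^ i) w + w'" "w \<in> W j" "w' \<in> W (Suc j)"
      unfolding T_def by (blast elim: span_insert_subspaceE[OF H])
    \<comment> \<open>These are the terms that have met \<open>H\<close> or started in
      \<open>W (Suc j)\<close>.\<close>
    let ?a = "br h ((br x ^^ i) w) + br h w' + sc c (br x w')"
    have "br g t = br h ((br x ^^ i) w) + br h w' + (sc c (br x ((br x ^^ i) w)) + sc c (br x w'))"
      unfolding g t by (simp add: br_simps algebra_simps)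
    then have "br g t = (br x ^^ Suc i) (sc c w) + ?a"
      by (simp add: endo.linear_scale[OF lin_funpow[OF lin_br[of x], of i]] br_simps algebra_simps)
    moreover have "br h ((br x ^^ i) w) \<in> W (Suc j)" "br h w' \<in> W (Suc j)"
      unfolding WS using g t stabp[OF t(2)] dec by (auto intro!: bracket_spanI)
    moreover have "br x w' \<in> W (Suc j)" using stab t by blast
    ultimately show "br g t \<in> T j (Suc i)"
      unfolding T_def using t by (blast intro: subspace_add[OF sW] subspace_scale[OF sW])
  qed
  have "W' (m * j) \<subseteq> W j" for j
  proof (induction j)
    case 0
    show ?case by (simp add: W0)
  next
    case (Suc j)
    have "W' (m * j + i) \<subseteq> T j i" for i
    proof (induction i)
      case 0
      have "w \<in> T j 0" if "w \<in> W j" for w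
      proof -
        have "w = (br x ^^ 0) w + 0" by simp
        then show ?thesis unfolding T_def using that subspace_0[OF sW] by blast
      qed
      then show ?case using Suc.IH by auto
    next
      case (Suc i)
      have "W' (m * j + Suc i) = bracket_span (span (insert x H)) (W' (m * j + i))" by (simp add: W'_def)
      also have "\<dots> \<subseteq> bracket_span (span (insert x H)) (T j i)" by (rule bracket_span_mono) (use Suc in auto)
      finally show ?case using step by blast
    qed
    from this[of m] have "W' (m * Suc j) \<subseteq> T j m" by (simp add: add.commute)
    also have "T j m \<subseteq> W (Suc j)" using m by (auto simp: T_def)
    finally show ?case .
  qed
  from this[of n] have "W' (m * n) \<subseteq> {0}" using n by (simp add: W_def)
  moreover have "0 \<in> W' (m * n)"
    unfolding W'_def by (rule subspace_0) (intro subspace_bracket_span_funpow, simp)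
  ultimately have "W' (m * n) = {0}" by auto
  then show ?thesis unfolding W'_def by blast
qed

text \<open>A subalgebra \<open>H\<close> of maximal dimension among those acting nilpotently is all
  of \<open>P\<close>. Otherwise bracket \<open>P\<close> repeatedly with \<open>H\<close>: the term
  just before this series first enters \<open>H\<close> supplies an \<open>x\<close> outside
  \<open>H\<close> with \<open>[H, x]\<close> inside \<open>H\<close>, and adjoining
  \<open>x\<close> contradicts maximality.\<close>

lemma engel:
  assumes P: "subspace P" "\<And>x y. x \<in> P \<Longrightarrow> y \<in> P \<Longrightarrow> br x y \<in> P"
    and nil: "\<And>x. x \<in> P \<Longrightarrow> \<exists>k. \<forall>v. (br x ^^ k) v = 0"
  shows "\<exists>n. (bracket_span P ^^ n) UNIV = {0}"
proof -
  define good where "good H \<longleftrightarrow> subspace H \<and> (\<forall>x\<in>H. \<forall>y\<in>H. br x y \<in> H) \<and> H \<subseteq> P \<and>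
    (\<exists>n. (bracket_span H ^^ n) UNIV = {0})" for H
  have "bracket_span {0} UNIV = {0}"
    using bracket_span_least[of "{0}" "{0}" UNIV] subspace_0[OF subspace_bracket_span]
    by (force simp: br_simps)
  then have "(bracket_span {0} ^^ 1) UNIV = {0}" by simp
  then have "good {0}" using P subspace_0 unfolding good_def by (auto simp: br_simps simp del: funpow.simps One_nat_def)
  moreover have "\<forall>H. good H \<longrightarrow> dim H \<le> dimension" using dim_subset_UNIV by blast
  ultimately obtain H where H: "good H" and max: "\<And>H'. good H' \<Longrightarrow> dim H' \<le> dim H"
    using ex_has_greatest_nat[of good "{0}" dim "Suc dimension"] by (auto simp: less_Suc_eq_le)
  from H obtain n where sH: "subspace H" and cH: "\<And>x y. x \<in> H \<Longrightarrow> y \<in> H \<Longrightarrow> br x y \<in> H" and HP: "H \<subseteq> P"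
    and n: "(bracket_span H ^^ n) UNIV = {0}" by (auto simp: good_def)
  have "H = P"
  proof (rule ccontr)
    assume "H \<noteq> P"
    then have nP: "\<not> P \<subseteq> H" using HP by blast
    define U where "U j = (bracket_span H ^^ j) P" for j
    have "U n \<subseteq> {0}" unfolding U_def using bracket_span_funpow_mono[of H H P UNIV n] n by auto
    then have "U n \<subseteq> H" using subspace_0[OF sH] by blast
    moreover have "\<not> U 0 \<subseteq> H" using nP by (simp add: U_def)
    ultimately obtain k where k: "\<not> U k \<subseteq> H" "U (Suc k) \<subseteq> H"
      using ex_least_nat_less[of "\<lambda>k. U k \<subseteq> H" n] by blast
    have UP: "U j \<subseteq> P" for j
    proof (induction j)
      case (Suc j)
      have "U (Suc j) = bracket_span H (U j)" by (simp add: U_def)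
      also have "\<dots> \<subseteq> P" by (rule bracket_span_least[OF P(1)]) (use Suc P(2) HP in blast)
      finally show ?case .
    qed (simp add: U_def)
    from k obtain x where x: "x \<in> U k" "x \<notin> H" by blast
    have xP: "x \<in> P" using x UP by blast
    have hx: "br h x \<in> H" if "h \<in> H" for h
    proof -
      have "br h x \<in> U (Suc k)" using bracket_spanI[OF that x(1)] by (simp add: U_def)
      then show ?thesis using k(2) by blast
    qed
    have xH: "br x h \<in> H" if "h \<in> H" for h
      using subspace_neg[OF sH hx[OF that]] br_anti[of h x] by simp
    let ?H = "span (insert x H)"
    obtain m where m: "\<And>v. (br x ^^ m) v = 0" using nil[OF xP] by auto
    have "good ?H"
      unfolding good_def
    proof (intro conjI ballI)
      show "?H \<subseteq> P" using span_minimal[OF _ P(1)] xP HP by simp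
      show "\<exists>n. (bracket_span ?H ^^ n) UNIV = {0}" by (rule bracket_nilpotent_extend[OF sH xH n m])
      fix a b assume "a \<in> ?H" "b \<in> ?H"
      then obtain c d h g where ab: "a = h + sc c x" "h \<in> H" "b = g + sc d x" "g \<in> H"
        by (blast elim: span_insert_subspaceE[OF sH])
      have "br a b = br h g - sc d (br x h) + sc c (br x g)"
        unfolding ab using br_anti[of x h] by (simp add: br_simps)
      also have "\<dots> \<in> H" using ab xH cH sH by (simp add: subspace_add subspace_diff subspace_scale)
      finally show "br a b \<in> ?H" by (auto intro: span_base)
    qed simp
    from max[OF this] have "dim ?H \<le> dim H" .
    then have "H = ?H" by (intro subspace_dim_equal sH) (auto intro: span_base)
    then show False using x(2) span_base by blast
  qed
  then show ?thesis using n by blast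
qed

text \<open>Bracketing with itself reproduces \<open>P\<close>, so \<open>P\<close> lies in every
  term of the series that Engel's theorem brings to zero.\<close>

lemma perfect_ad_nilpotent_trivial:
  assumes P: "subspace P" "bracket_span P P = P"
    and nil: "\<And>x. x \<in> P \<Longrightarrow> \<exists>k. \<forall>v. (br x ^^ k) v = 0"
  shows "P = {0}"
proof -
  have "br x y \<in> P" if "x \<in> P" "y \<in> P" for x y using P(2) bracket_spanI[OF that] by simp
  then obtain n where n: "(bracket_span P ^^ n) UNIV = {0}" using engel[OF P(1) _ nil] by blast
  have "P \<subseteq> (bracket_span P ^^ k) UNIV" for k
  proof (induction k)
    case (Suc k)
    then show ?case using bracket_span_mono[OF subset_refl Suc, of P] P(2) by simp
  qed simp
  from this[of n] n subspace_0[OF P(1)] show ?thesis by blast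
qed

end

section \<open>The Killing form and its radical\<close>

context complex_lie_algebra
begin

definition killing :: "'a \<Rightarrow> 'a \<Rightarrow> complex" where
  "killing x y = trace (\<lambda>v. br x (br y v))"

lemma killing_commute: "killing x y = killing y x"
  unfolding killing_def by (rule trace_comp_commute[OF lin_br lin_br])

text \<open>\<open>br (D x)\<close> is the commutator of \<open>D\<close> and \<open>br x\<close>,
  and the trace is cyclic. Outer derivations are included because the lemma is applied to
  \<open>p x\<close>.\<close>

lemma killing_derivation:
  assumes D: "derivation D"
  shows "killing (D x) y = - killing x (D y)"
proof -
  have l: "lin D" using D by (simp add: derivation_def)
  have e: "br (D u) v = D (br u v) - br u (D v)" for u v
    using D by (simp add: derivation_def)
  have "killing (D x) y = trace (\<lambda>v. D (br x (br y v))) - trace (\<lambda>v. br x (D (br y v)))"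
    unfolding killing_def e by (rule trace_diff)
  also have "trace (\<lambda>v. D (br x (br y v))) = trace (\<lambda>v. br x (br y (D v)))"
    by (rule trace_comp_commute[OF l lin_comp[OF lin_br lin_br]])
  finally show ?thesis
    unfolding killing_def e by (simp add: br_simps trace_diff)
qed

definition killing_radical :: "'a set" where
  "killing_radical = {x. \<forall>y. killing x y = 0}"

lemma subspace_killing_radical: "subspace killing_radical"
  by (rule subspaceI)
    (auto simp: killing_radical_def killing_def br_simps trace_zero trace_add trace_scale)

section \<open>Solvability of the radical\<close>

primrec derived :: "nat \<Rightarrow> 'a set" where
  "derived 0 = killing_radical"
| "derived (Suc n) = bracket_span (derived n) (derived n)"

lemma subspace_derived: "subspace (derived n)"
  by (cases n) (simp_all add: subspace_killing_radical subspace_bracket_span)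

text \<open>Allowing all derivations makes each term an ideal and also invariant under every
  multiplication \<open>p x\<close>.\<close>

lemma derivation_derived: "derivation D \<Longrightarrow> D ` derived n \<subseteq> derived n"
proof (induction n)
  case 0
  then show ?case by (auto simp: killing_radical_def killing_derivation)
next
  case (Suc n)
  then show ?case by (simp add: derivation_bracket_span)
qed

lemma derived_decreasing: "derived (Suc n) \<subseteq> derived n"
proof -
  have "bracket_span (derived n) (derived n) \<subseteq> derived n"
    using derivation_derived[OF derivation_br]
    by (intro bracket_span_least subspace_derived) blast
  then show ?thesis by simp
qed

lemma derived_subset: "derived n \<subseteq> killing_radical"
proof (induction n)
  case (Suc n)
  then show ?case using derived_decreasing[of n] by blast
qed simp

lemma ex_derived_stable: "\<exists>n. derived (Suc n) = derived n"
proof (rule ccontr)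
  assume "\<not> ?thesis"
  then have ne: "derived (Suc n) \<noteq> derived n" for n by blast
  have lt: "dim (derived (Suc n)) < dim (derived n)" for n
  proof (rule ccontr)
    assume "\<not> ?thesis"
    then have "derived (Suc n) = derived n"
      by (intro subspace_dim_equal subspace_derived derived_decreasing) simp
    then show False using ne by blast
  qed
  have "dim (derived n) + n \<le> dim (derived 0)" for n
  proof (induction n)
    case (Suc n)
    then show ?case using lt[of n] by linarith
  qed simp
  from this[of "Suc (dim (derived 0))"] show False by simp
qed

text \<open>For \<open>x = br y z\<close> the trace of \<open>E\<close> after \<open>br x\<close>
  equals \<open>killing z (E y)\<close>, which is zero as \<open>z\<close> is in the radical,
  wherever \<open>E y\<close> lies. Perfectness of \<open>P\<close> and linearity carry this to
  every \<open>x\<close> in \<open>P\<close>.\<close>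

lemma perfect_in_killing_radical_trivial:
  assumes P: "subspace P" "bracket_span P P = P" "P \<subseteq> killing_radical"
  shows "P = {0}"
proof (rule perfect_ad_nilpotent_trivial[OF P(1,2)])
  fix x assume x: "x \<in> P"
  show "\<exists>k. \<forall>v. (br x ^^ k) v = 0"
  proof (rule derivation_nilpotent_if_trace_zero[OF derivation_br])
    fix E assume E: "derivation E"
    then have l: "lin E" by (simp add: derivation_def)
    let ?Z = "{x. trace (\<lambda>v. E (br x v)) = 0}"
    have "bracket_span P P \<subseteq> ?Z"
    proof (rule bracket_span_least)
      show "subspace ?Z"
        by (rule subspaceI)
          (auto simp: br_simps endo.linear_0[OF l] endo.linear_add[OF l] endo.linear_scale[OF l]
            trace_zero trace_add trace_scale)
      fix y z assume "y \<in> P" "z \<in> P"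
      have "0 = killing z (E y)" using \<open>z \<in> P\<close> P(3) by (auto simp: killing_radical_def)
      also have "\<dots> = trace (\<lambda>v. br (E y) (br z v))" using killing_commute[of z "E y"] by (simp only: killing_def)
      also have "(\<lambda>v. br (E y) (br z v)) = (\<lambda>v. E (br y (br z v)) - br y (E (br z v)))"
        using E by (simp add: derivation_def)
      \<comment> \<open>Cyclicity brings \<open>E\<close> to the front of the second term, so that
        the Jacobi identity can merge the two.\<close>
      also have "trace \<dots> = trace (\<lambda>v. E (br y (br z v))) - trace (\<lambda>v. E (br z (br y v)))"
        unfolding trace_diff
        using trace_comp_commute[OF lin_comp[OF l lin_br] lin_br, of z y] by simp
      also have "\<dots> = trace (\<lambda>v. E (br (br y z) v))"
        unfolding trace_diff[symmetric] jacobi[of y z] by (simp add: endo.linear_add[OF l])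
      finally show "br y z \<in> ?Z" by simp
    qed
    then show "trace (\<lambda>v. E (br x v)) = 0" using x P(2) by auto
  qed
qed

lemma ex_derived_trivial: "\<exists>n. derived n = {0}"
proof -
  from ex_derived_stable obtain n where "derived (Suc n) = derived n" ..
  then have "bracket_span (derived n) (derived n) = derived n" by simp
  then have "derived n = {0}"
    by (rule perfect_in_killing_radical_trivial[OF subspace_derived _ derived_subset])
  then show ?thesis by blast
qed

end

section \<open>Commutative post-Lie structures on perfect Lie algebras\<close>

locale perfect_complex_cpa = complex_lie_algebra sc Basis br
  for sc :: "complex \<Rightarrow> 'a::ab_group_add \<Rightarrow> 'a" and Basis br +
  fixes p :: "'a \<Rightarrow> 'a \<Rightarrow> 'a"
  assumes cpa: "CPA_structure sc br p" and perfect: "perfect_lie sc br"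
begin

lemma lin_p: "lin (p x)"
  and lin_p_left: "lin (\<lambda>x. p x y)"
  and p_commute: "p x y = p y x"
  and p_br_left: "p (br x y) z = p x (p y z) - p y (p x z)"
  and p_br: "p x (br y z) = br (p x y) z + br y (p x z)"
  using cpa unfolding CPA_structure_def by blast+

lemma derivation_p: "derivation (p x)"
  unfolding derivation_def using lin_p p_br by blast

text \<open>All uses of the perfectness of the algebra pass through here: a linear condition need
  only be checked on brackets.\<close>

lemma perfect_linear_subspace:
  assumes "lin f" "subspace J" "\<And>x y. f (br x y) \<in> J"
  shows "f x \<in> J"
proof -
  have "x \<in> bracket_span UNIV UNIV"
    using perfect by (simp add: bracket_span_def perfect_lie_def)
  also have "\<dots> \<subseteq> f -` J"
    by (rule bracket_span_least[OF endo.linear_subspace_vimage[OF assms(1,2)]]) (use assms(3) in auto)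
  finally show ?thesis by simp
qed

lemma p_in_killing_radical: "p x y \<in> killing_radical"
proof -
  define f where "f x y z = killing (p x y) z" for x y z
  have 1: "f x y z = f y x z" for x y z by (simp add: f_def p_commute)
  have 2: "f x y z = - f x z y" for x y z
    using killing_derivation[OF derivation_p, of x y z] killing_commute by (simp add: f_def)
  \<comment> \<open>Alternating the two swaps, three times each, returns to the same triple with
    three sign changes.\<close>
  have "f x y z = - f x y z" for z
    using 1 2 by (metis add.inverse_inverse)
  then have "f x y z = 0" for z by (simp add: eq_neg_iff_add_eq_0)
  then show ?thesis by (simp add: killing_radical_def f_def)
qed

text \<open>On the abelian quotient \<open>I / J\<close> the operators \<open>L\<close> (multiplication) and \<open>\<rho>\<close> (bracket) commute
  and \<open>[L y, L z] = \<rho> y L z - \<rho> z L y\<close>. Expanding \<open>L [[y, z], w]\<close> in two ways shows that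
  \<open>\<rho> [y, w] L z\<close>, antisymmetric in \<open>y, w\<close>, is symmetric in \<open>y, z\<close>, so that it vanishes.\<close>

lemma p_descends:
  assumes I: "\<And>D. derivation D \<Longrightarrow> D ` I \<subseteq> I"
    and J: "subspace J" "\<And>D. derivation D \<Longrightarrow> D ` J \<subseteq> J"
    and IJ: "bracket_span I I \<subseteq> J" and pI: "\<And>x y. p x y \<in> I"
  shows "p x y \<in> J"
proof -
  have L: "p (br y z) a = br y (p z a) - br z (p y a)" for y z a
    using p_br[of a y z] br_anti[of z "p a y"] p_commute by simp
  \<comment> \<open>The defect is \<open>br (p w y) a\<close>, a bracket of two elements of
    \<open>I\<close>.\<close>
  have comm: "p w (br y a) - br y (p w a) \<in> J" if "a \<in> I" for w y a
    using subsetD[OF IJ bracket_spanI[OF pI that]] by (simp add: p_br)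
  have key: "br u (p z a) \<in> J" if a: "a \<in> I" for u z a
  proof -
    define f where "f y w z = br (br y w) (p z a)" for y w z
    have anti: "f y w z = - f w y z" for y w z
      using br_anti[of w y] by (simp add: f_def br_simps)
    have sym: "f y w z - f z w y \<in> J" for y w z
    proof -
      let ?e = "\<lambda>y z. p w (br y (p z a)) - br y (p w (p z a))"
      have pp: "p v (p w a) = br v (p w a) - br w (p v a) + p w (p v a)" for v
        using p_br_left[of v w a] L[of v w a] by (simp add: algebra_simps)
      \<comment> \<open>\<open>?l\<close> expands \<open>p (br (br y z) w) a\<close> by
        \<open>L\<close>, \<open>?r\<close> by \<open>p_br_left\<close>, with \<open>pp\<close>
        bringing \<open>p w\<close> outermost in each double product. Equating them leaves the two
        \<open>f\<close> terms against the defects \<open>?e\<close>.\<close>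
      have "br y (br z (p w a)) - br z (br y (p w a)) - br w (br y (p z a)) + br w (br z (p y a))
          = br (br y z) (p w a) - br w (br y (p z a) - br z (p y a))" (is "?l = _")
        using jacobi[of y z "p w a"] by (simp add: br_simps)
      also have "\<dots> = p (br (br y z) w) a" unfolding L ..
      also have "\<dots> = p (br y z) (p w a) - p w (p (br y z) a)" by (rule p_br_left)
      also have "\<dots> = br y (p z (p w a)) - br z (p y (p w a)) - p w (br y (p z a) - br z (p y a))"
        by (simp only: L)
      also have "\<dots> = br y (br z (p w a)) - br y (br w (p z a)) + br y (p w (p z a))
            - (br z (br y (p w a)) - br z (br w (p y a)) + br z (p w (p y a)))
            - (p w (br y (p z a)) - p w (br z (p y a)))" (is "_ = ?r")
        unfolding pp by (simp only: endo.linear_add[OF lin_br] endo.linear_diff[OF lin_br] endo.linear_diff[OF lin_p])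
      finally have "?l = ?r" .
      have "f y w z = br y (br w (p z a)) - br w (br y (p z a))"
        using jacobi[of y w "p z a"] by (simp add: f_def)
      moreover have "f z w y = br z (br w (p y a)) - br w (br z (p y a))"
        using jacobi[of z w "p y a"] by (simp add: f_def)
      ultimately have "f y w z - f z w y = ?e z y - ?e y z + (?l - ?r)"
        by simp
      then have "f y w z - f z w y = ?e z y - ?e y z" using \<open>?l = ?r\<close> by (simp only: diff_self add_0_right)
      moreover have "?e z y - ?e y z \<in> J" by (intro subspace_diff[OF J(1)] comm pI)
      ultimately show ?thesis by simp
    qed
    have f: "f y w z \<in> J" for y w z
    proof -
      \<comment> \<open>Antisymmetry in the first two arguments cancels four of the six terms and
        doubles \<open>f y w z\<close>.\<close>
      have "(f y w z - f z w y) - (f w z y - f y z w) + (f z y w - f w y z) = sc 2 (f y w z)"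
        using anti[of z w y] anti[of y z w] anti[of w y z] scale_left_distrib[of 1 1 "f y w z"] by simp
      moreover have "(f y w z - f z w y) - (f w z y - f y z w) + (f z y w - f w y z) \<in> J"
        by (intro subspace_add subspace_diff J(1) sym)
      ultimately have "sc (1/2) (sc 2 (f y w z)) \<in> J" using subspace_scale[OF J(1)] by metis
      then show ?thesis by simp
    qed
    show ?thesis
      by (rule perfect_linear_subspace[OF lin_br_left J(1)]) (use f in \<open>simp add: f_def\<close>)
  qed
  \<comment> \<open>With \<open>key\<close>, the law \<open>L\<close> sends products with a factor
    in \<open>I\<close> into \<open>J\<close>; \<open>p_br_left\<close> then reduces a general
    product to such ones, the factor in \<open>I\<close> being itself a product.\<close>
  have pIJ: "p u a \<in> J" if "a \<in> I" for u a
    by (rule perfect_linear_subspace[OF lin_p_left J(1)]) (simp add: L key that subspace_diff[OF J(1)])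
  show ?thesis
    by (rule perfect_linear_subspace[OF lin_p_left J(1)])
      (simp add: p_br_left pIJ pI subspace_diff[OF J(1)])
qed

lemma p_in_derived: "p x y \<in> derived n"
proof (induction n arbitrary: x y)
  case 0
  then show ?case by (simp add: p_in_killing_radical)
next
  case (Suc n)
  show ?case
    by (rule p_descends[OF derivation_derived subspace_derived derivation_derived _ Suc]) auto
qed

lemma p_trivial: "p x y = 0"
  using ex_derived_trivial p_in_derived by blast

end

theorem theorem3p3:
  fixes sc :: "complex \<Rightarrow> 'a::ab_group_add \<Rightarrow> 'a"
    and br p :: "'a \<Rightarrow> 'a \<Rightarrow> 'a"
  assumes "lie_algebra sc br"
    and "fin_dim sc"
    and "perfect_lie sc br"
    and "CPA_structure sc br p"
  shows "\<forall>x y. p x y = 0"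
proof -
  obtain B where "finite_dimensional_vector_space sc B"
    using assms(2) by (auto simp: fin_dim_def)
  then interpret finite_dimensional_vector_space sc B .
  interpret perfect_complex_cpa sc B br p
    by unfold_locales (fact assms)+
  show ?thesis using p_trivial by blast
qed

end
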